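(* Let $\mathcal{E}$ be an ellipse in a real affine plane. Consider two Euclidean structures (positive definite quadratic forms on the plane's vector space) on this plane; each makes the plane Euclidean and thus defines a pair of foci of $\mathcal{E}$ and a major axis of $\mathcal{E}$. Let $\ell$ be a chord of $\mathcal{E}$ passing through two foci, one of each pair. Then the two major axes (each measured with its own Euclidean structure) have equal length if and only if the two Euclidean structures induce equal units of length on the chord $\ell$ (i.e. assign the same length to $\ell$). *)

theory Defs
  imports "HOL-Analysis.Analysis"
begin

text \<open>The real affine plane is modelled as real^2 (points and translation vectors).
A Euclidean structure is a positive definite quadratic form x \<mapsto> x \<bullet> (A *v x)
given by a symmetric matrix A.\<close>

definition euclidean_structure :: "real^2^2 \<Rightarrow> bool" where
  "euclidean_structure A \<longleftrightarrow> transpose A = A \<and> (\<forall>x. x \<noteq> 0 \<longrightarrow> x \<bullet> (A *v x) > 0)"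

text \<open>Length of a vector with respect to the Euclidean structure A.\<close>
definition qnorm :: "real^2^2 \<Rightarrow> real^2 \<Rightarrow> real" where
  "qnorm A x = sqrt (x \<bullet> (A *v x))"

text \<open>An ellipse (an affine notion): image of the unit circle under an invertible affine map.\<close>
definition is_ellipse :: "(real^2) set \<Rightarrow> bool" where
  "is_ellipse E \<longleftrightarrow> (\<exists>M c. invertible (M :: real^2^2) \<and> E = {c + M *v u | u. norm u = 1})"

text \<open>F1, F2 are the foci of E in the Euclidean structure A: E is the locus of points
whose distances to F1 and F2 have constant sum.\<close>
definition foci :: "real^2^2 \<Rightarrow> (real^2) set \<Rightarrow> real^2 \<Rightarrow> real^2 \<Rightarrow> bool" where
  "foci A E F1 F2 \<longleftrightarrow> (\<exists>a. E = {P. qnorm A (P - F1) + qnorm A (P - F2) = a})"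

text \<open>Length of the major axis of E in the Euclidean structure A: the longest chord.\<close>
definition major_axis_length :: "real^2^2 \<Rightarrow> (real^2) set \<Rightarrow> real" where
  "major_axis_length A E = (SUP P\<in>E. SUP Q\<in>E. qnorm A (P - Q))"

end

theory Submission
  imports Defs
begin

text \<open>Write \<open>E = {c + M u | |u| = 1}\<close> and a Euclidean structure as \<open>x \<mapsto> |R x|\<close>. In the
coordinates given by \<open>R\<close> the structure becomes the standard one, \<open>E\<close> becomes the image of the
unit circle under \<open>u \<mapsto> c' + N u\<close> with \<open>N = R M\<close>, and \<open>E\<close> is the focal locus
\<open>|X - F1| + |X - F2| = a\<close>, whose diameter (the major axis) is \<open>a\<close>. The point reflections in
\<open>c'\<close> and in the midpoint of the foci both preserve this bounded set, so their composite, a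
translation, is trivial and the two centres coincide. Substituting \<open>X = c' + N u\<close> into the focal
equation then yields \<open>4a\<^sup>2|N w|\<^sup>2 - 4(N w \<bullet> (F2 - F1))\<^sup>2 = a\<^sup>2(a\<^sup>2 - |F2 - F1|\<^sup>2)|w|\<^sup>2\<close>. Combined with
the harmonic relation between the focal radii of the two ends of a chord through \<open>F1\<close>, this
shows that such a chord with ends \<open>c + M w1\<close>, \<open>c + M w2\<close> has length \<open>a |w1 - w2|\<^sup>2 / 4\<close>, and
the factor \<open>|w1 - w2|\<^sup>2\<close> does not depend on the Euclidean structure.\<close>

lemma bounded_translation_invariant_eq_0:
  fixes S :: "'a::real_normed_vector set"
  assumes "bounded S" and "x \<in> S" and invariant: "\<And>y. y \<in> S \<Longrightarrow> y + t \<in> S"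
  shows "t = 0"
proof (rule ccontr)
  assume "t \<noteq> 0"
  obtain B where B: "\<And>y. y \<in> S \<Longrightarrow> norm y \<le> B"
    using \<open>bounded S\<close> unfolding bounded_iff by blast
  have orbit: "x + real k *\<^sub>R t \<in> S" for k
  proof (induction k)
    case 0
    then show ?case using \<open>x \<in> S\<close> by simp
  next
    case (Suc k)
    then show ?case using invariant[OF Suc] by (simp add: algebra_simps)
  qed
  have "real k * norm t \<le> B + norm x" for k
  proof -
    have "real k * norm t = norm ((x + real k *\<^sub>R t) - x)" by simp
    also have "\<dots> \<le> norm (x + real k *\<^sub>R t) + norm x" by (rule norm_triangle_ineq4)
    finally show ?thesis using B[OF orbit[of k]] by linarith
  qed
  moreover obtain k where "B + norm x < real k * norm t"
    using ex_less_of_nat_mult[of "norm t"] \<open>t \<noteq> 0\<close> by auto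
  ultimately show False by (meson not_le)
qed

lemma complementary_weights_product:
  fixes z x y l :: "'a::field"
  assumes x: "z * x = l" and y: "(1 - z) * y = l"
  shows "x * y = l * (x + y)"
proof (cases "z = 0 \<or> z = 1")
  case True
  then show ?thesis using assms by auto
next
  case False
  have "z * (1 - z) * (x * y) = (z * x) * ((1 - z) * y)" by (simp add: algebra_simps)
  also have "\<dots> = l * ((1 - z) * (z * x) + z * ((1 - z) * y))" unfolding x y by (simp add: algebra_simps)
  also have "\<dots> = z * (1 - z) * (l * (x + y))" by (simp add: algebra_simps)
  finally show ?thesis using False by simp
qed

lemma focal_radius_eq:
  fixes X F1 F2 :: "'a::real_inner"
  assumes "norm (X - F1) + norm (X - F2) = a"
  shows "2 * a * norm (X - F1) = a\<^sup>2 - (norm (F2 - F1))\<^sup>2 + 2 * ((X - F1) \<bullet> (F2 - F1))"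
proof -
  have "a - norm (X - F1) = norm ((X - F1) - (F2 - F1))"
    using assms by simp
  then have "(a - norm (X - F1))\<^sup>2 = (norm (X - F1))\<^sup>2 - 2 * ((X - F1) \<bullet> (F2 - F1)) + (norm (F2 - F1))\<^sup>2"
    by (simp add: power2_norm_eq_inner inner_diff_left inner_diff_right inner_commute)
  then show ?thesis unfolding power2_diff by linarith
qed

locale focal_ellipsoid =
  fixes f :: "'a::{real_normed_vector, perfect_space} \<Rightarrow> 'b::real_inner"
    and c F1 F2 :: 'b and a :: real
  assumes linear_f: "linear f" and inj_f: "inj f"
    and ellipsoid_eq_focal_locus:
      "{c + f u | u. norm u = 1} = {X. norm (X - F1) + norm (X - F2) = a}"
begin

lemma on_focal_locus: "norm u = 1 \<Longrightarrow> norm (c + f u - F1) + norm (c + f u - F2) = a"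
  using ellipsoid_eq_focal_locus by blast

lemma focal_locus_point:
  assumes "norm (X - F1) + norm (X - F2) = a"
  obtains u where "norm u = 1" and "X = c + f u"
  using assms ellipsoid_eq_focal_locus by blast

lemma center_eq_midpoint: "c = midpoint F1 F2"
proof -
  let ?locus = "{X. norm (X - F1) + norm (X - F2) = a}"
  \<comment> \<open>the reflections in \<open>c\<close> and in the midpoint of the foci both preserve the locus\<close>
  define t where "t = F1 + F2 - 2 *\<^sub>R c"
  have invariant: "X + t \<in> ?locus" if X_on: "X \<in> ?locus" for X
  proof -
    from X_on have "norm (X - F1) + norm (X - F2) = a" by simp
    then obtain u where u: "norm u = 1" and X: "X = c + f u" by (rule focal_locus_point)
    have "c + f (- u) = F1 + F2 - (X + t)"
      using X by (simp add: t_def linear_neg[OF linear_f] scaleR_2 algebra_simps)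
    then show ?thesis
      using on_focal_locus[of "- u"] u by (simp add: norm_minus_commute add.commute)
  qed
  have bounded: "bounded ?locus"
    by (rule bounded_subset[OF bounded_cball[of F1 a]]) (auto simp: dist_norm norm_minus_commute)
  obtain u :: 'a where "norm u = 1" using vector_choose_size zero_le_one .
  then have "c + f u \<in> ?locus" by (simp add: on_focal_locus)
  then have "t = 0" by (rule bounded_translation_invariant_eq_0[OF bounded _ invariant])
  then show ?thesis by (metis t_def midpoint_eq_iff eq_iff_diff_eq_0 scaleR_2)
qed

lemma foci_dist_less: "norm (F2 - F1) < a"
proof -
  obtain u :: 'a where u: "norm u = 1" using vector_choose_size zero_le_one .
  have "norm (F2 - F1) \<le> norm (c + f u - F1) + norm (c + f u - F2)"
    using norm_triangle_ineq4[of "c + f u - F1" "c + f u - F2"] by simp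
  then have le: "norm (F2 - F1) \<le> a" using on_focal_locus[OF u] by simp
  have center_sum: "norm (c - F1) + norm (c - F2) = norm (F2 - F1)"
    using dist_midpoint(3,4)[of F1 F2] center_eq_midpoint by (simp add: dist_norm norm_minus_commute)
  \<comment> \<open>if the focal sum were \<open>|F2 - F1|\<close>, the centre would lie on the ellipse\<close>
  have "norm (c - F1) + norm (c - F2) \<noteq> a"
  proof
    assume "norm (c - F1) + norm (c - F2) = a"
    then obtain v where "norm v = 1" "c = c + f v" by (rule focal_locus_point)
    then show False
      using inj_f linear_inj_iff_eq_0[OF linear_f] by auto
  qed
  then show ?thesis using le center_sum by linarith
qed

lemma focal_quadratic_form_sphere:
  assumes "norm u = 1"
  shows "4 * a\<^sup>2 * (norm (f u))\<^sup>2 - 4 * (f u \<bullet> (F2 - F1))\<^sup>2 = a\<^sup>2 * (a\<^sup>2 - (norm (F2 - F1))\<^sup>2)"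
proof -
  define g where "g = F2 - F1"
  have "g = 2 *\<^sub>R (c - F1)"
    using center_eq_midpoint midpoint_plus_self[of F1 F2] by (simp add: g_def scaleR_2 algebra_simps)
  then have "c - F1 = (1/2) *\<^sub>R g" by simp
  then have radius: "c + f u - F1 = f u + (1/2) *\<^sub>R g" by (simp add: algebra_simps)
  have "2 * a * norm (f u + (1/2) *\<^sub>R g) = a\<^sup>2 + 2 * (f u \<bullet> g)"
    using focal_radius_eq[OF on_focal_locus[OF assms]]
    by (simp add: radius g_def inner_add_left power2_norm_eq_inner)
  then have "4 * a\<^sup>2 * (norm (f u + (1/2) *\<^sub>R g))\<^sup>2 = (a\<^sup>2 + 2 * (f u \<bullet> g))\<^sup>2"
    by (metis power_mult_distrib numeral_Bit0_eq_double power2_eq_square)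
  moreover have "(norm (f u + (1/2) *\<^sub>R g))\<^sup>2 = (norm (f u))\<^sup>2 + f u \<bullet> g + (norm g)\<^sup>2 / 4"
    by (simp add: power2_norm_eq_inner inner_add_left inner_add_right inner_commute)
  ultimately show ?thesis unfolding g_def[symmetric] by (simp add: power2_eq_square algebra_simps)
qed

lemma focal_quadratic_form:
  "4 * a\<^sup>2 * (norm (f w))\<^sup>2 - 4 * (f w \<bullet> (F2 - F1))\<^sup>2
     = a\<^sup>2 * (a\<^sup>2 - (norm (F2 - F1))\<^sup>2) * (norm w)\<^sup>2"
proof (cases "w = 0")
  case True
  then show ?thesis by (simp add: linear_0[OF linear_f])
next
  case False
  define u where "u = (1 / norm w) *\<^sub>R w"
  define g where "g = F2 - F1"
  have "norm u = 1" using False by (simp add: u_def)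
  have "f w = norm w *\<^sub>R f u"
    using False by (simp add: u_def linear_scale[OF linear_f])
  then have "4 * a\<^sup>2 * (norm (f w))\<^sup>2 - 4 * (f w \<bullet> g)\<^sup>2
      = (norm w)\<^sup>2 * (4 * a\<^sup>2 * (norm (f u))\<^sup>2 - 4 * (f u \<bullet> g)\<^sup>2)"
    by (simp add: power_mult_distrib algebra_simps)
  then show ?thesis
    unfolding g_def focal_quadratic_form_sphere[OF \<open>norm u = 1\<close>] by simp
qed

lemma focal_chord:
  assumes "norm w1 = 1" and "norm w2 = 1"
    and "F1 \<in> closed_segment (c + f w1) (c + f w2)"
  shows "a * (norm (w1 - w2))\<^sup>2 = 4 * norm (f w1 - f w2)"
proof -
  define v where "v = f w1 - f w2"
  define l where "l = a\<^sup>2 - (norm (F2 - F1))\<^sup>2"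
  obtain z where z: "0 \<le> z" "z \<le> 1" and F1: "F1 = (1 - z) *\<^sub>R (c + f w1) + z *\<^sub>R (c + f w2)"
    using assms(3) unfolding closed_segment_def by blast
  have P: "c + f w1 - F1 = z *\<^sub>R v" and Q: "c + f w2 - F1 = - ((1 - z) *\<^sub>R v)"
    unfolding F1 v_def by (simp_all add: algebra_simps)
  have "2 * a * (z * norm v) = l + 2 * (z * (v \<bullet> (F2 - F1)))"
    using focal_radius_eq[OF on_focal_locus[OF assms(1)]] z
    unfolding P norm_scaleR inner_scaleR_left by (simp add: l_def)
  then have "z * (2 * a * norm v - 2 * (v \<bullet> (F2 - F1))) = l"
    by (simp add: algebra_simps)
  moreover have "2 * a * ((1 - z) * norm v) = l - 2 * ((1 - z) * (v \<bullet> (F2 - F1)))"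
    using focal_radius_eq[OF on_focal_locus[OF assms(2)]] z
    unfolding Q norm_minus_cancel norm_scaleR inner_minus_left inner_scaleR_left by (simp add: l_def)
  then have "(1 - z) * (2 * a * norm v + 2 * (v \<bullet> (F2 - F1))) = l"
    by (simp add: algebra_simps)
  ultimately have "(2 * a * norm v - 2 * (v \<bullet> (F2 - F1))) * (2 * a * norm v + 2 * (v \<bullet> (F2 - F1)))
      = l * (4 * a * norm v)"
    by (rule complementary_weights_product[THEN trans]) (simp add: algebra_simps)
  moreover have "f (w1 - w2) = v" by (simp add: v_def linear_diff[OF linear_f])
  ultimately have cancel: "a * l * (a * (norm (w1 - w2))\<^sup>2) = a * l * (4 * norm v)"
    using focal_quadratic_form[of "w1 - w2"] by (simp add: l_def power2_eq_square algebra_simps)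
  have "0 < a" using foci_dist_less norm_ge_zero[of "F2 - F1"] by linarith
  moreover have "0 < l"
    using foci_dist_less unfolding l_def by (simp add: power_strict_mono)
  ultimately have "a * l \<noteq> 0" by simp
  then show ?thesis using cancel unfolding v_def by simp
qed

end

lemma SUP_SUP_eq_attained:
  fixes \<phi> :: "'a \<Rightarrow> 'a \<Rightarrow> 'b::conditionally_complete_lattice"
  assumes le: "\<And>P Q. P \<in> E \<Longrightarrow> Q \<in> E \<Longrightarrow> \<phi> P Q \<le> a"
    and "P0 \<in> E" and "Q0 \<in> E" and "\<phi> P0 Q0 = a"
  shows "(SUP P\<in>E. SUP Q\<in>E. \<phi> P Q) = a"
proof -
  have inner_le: "(SUP Q\<in>E. \<phi> P Q) \<le> a" if "P \<in> E" for P
    using assms that by (intro cSUP_least) auto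
  have inner_bdd: "bdd_above (\<phi> P ` E)" if "P \<in> E" for P
    using le that by (intro bdd_aboveI[of _ a]) auto
  have attained: "a \<le> (SUP Q\<in>E. \<phi> P0 Q)"
    by (rule cSUP_upper2[OF inner_bdd[OF assms(2)] assms(3)]) (simp add: assms(4))
  have "bdd_above ((\<lambda>P. SUP Q\<in>E. \<phi> P Q) ` E)"
    using inner_le by (intro bdd_aboveI[of _ a]) auto
  then have "a \<le> (SUP P\<in>E. SUP Q\<in>E. \<phi> P Q)"
    by (rule cSUP_upper2[where f = "\<lambda>P. SUP Q\<in>E. \<phi> P Q", OF _ assms(2) attained])
  moreover have "(SUP P\<in>E. SUP Q\<in>E. \<phi> P Q) \<le> a"
    using assms inner_le by (intro cSUP_least) auto
  ultimately show ?thesis by simp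
qed

lemma focal_locus_diameter:
  fixes F1 F2 :: "'a::{real_normed_vector, perfect_space}"
  assumes E: "E = {X. norm (X - F1) + norm (X - F2) = a}" and "E \<noteq> {}"
  shows "(SUP P\<in>E. SUP Q\<in>E. norm (P - Q)) = a"
proof -
  have chord_le: "norm (P - Q) \<le> a" if "P \<in> E" "Q \<in> E" for P Q
  proof -
    have triangle: "norm (P - Q) \<le> norm (P - F) + norm (Q - F)" for F
      using norm_triangle_ineq4[of "P - F" "Q - F"] by simp
    show ?thesis
      using that E triangle[of F1] triangle[of F2] by simp
  qed
  obtain X where "X \<in> E" using assms(2) by blast
  then have "norm (F2 - F1) \<le> a"
    using E norm_triangle_ineq4[of "X - F1" "X - F2"] by simp
  define d where "d = norm (F2 - F1)"
  have d: "0 \<le> d" "d \<le> a" using \<open>norm (F2 - F1) \<le> a\<close> by (simp_all add: d_def)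
  obtain u :: 'a where u: "norm u = 1" and F2: "F2 = F1 + d *\<^sub>R u"
  proof (cases "F1 = F2")
    case True
    obtain b :: 'a where "norm b = 1" using vector_choose_size zero_le_one .
    then show ?thesis using True by (intro that[of b]) (simp_all add: d_def)
  next
    case False
    then show ?thesis using that[of "(1 / d) *\<^sub>R (F2 - F1)"] by (simp add: d_def)
  qed
  define P0 where "P0 = F1 + ((d + a) / 2) *\<^sub>R u"
  define Q0 where "Q0 = F1 + ((d - a) / 2) *\<^sub>R u"
  have halves: "(d + a) / 2 + (a - d) / 2 = a" by (simp add: field_simps)
  have "P0 - F2 = ((a - d) / 2) *\<^sub>R u"
    using F2 by (simp add: P0_def scaleR_diff_left[symmetric] field_simps)
  then have "norm (P0 - F1) = (d + a) / 2" and "norm (P0 - F2) = (a - d) / 2"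
    using u d by (simp_all add: P0_def)
  then have P0: "P0 \<in> E" using E halves by simp
  have "Q0 - F2 = - (((d + a) / 2) *\<^sub>R u)"
    using F2 by (simp add: Q0_def flip: scaleR_diff_left scaleR_minus_left) (simp add: field_simps)
  then have "norm (Q0 - F1) = (a - d) / 2" and "norm (Q0 - F2) = (d + a) / 2"
    using u d by (simp_all add: Q0_def)
  then have Q0: "Q0 \<in> E" using E halves by (simp add: add.commute)
  have "P0 - Q0 = a *\<^sub>R u"
    by (simp add: P0_def Q0_def flip: scaleR_diff_left) (simp add: field_simps)
  then have "norm (P0 - Q0) = a" using u d by simp
  with chord_le P0 Q0 show ?thesis by (rule SUP_SUP_eq_attained)
qed

lemma euclidean_structure_factor:
  assumes "euclidean_structure A"
  obtains R :: "real^2^2" where "invertible R" and "\<And>x. qnorm A x = norm (R *v x)"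
proof -
  define p r t where "p = A$1$1" and "r = A$1$2" and "t = A$2$2"
  have "A$2$1 = (transpose A)$1$2" by (simp add: transpose_def)
  then have sym: "A$2$1 = r"
    using assms by (simp add: euclidean_structure_def r_def)
  have form: "x \<bullet> (A *v x) = p * (x$1)\<^sup>2 + 2 * r * (x$1) * (x$2) + t * (x$2)\<^sup>2" for x :: "real^2"
    by (simp add: inner_vec_def matrix_vector_mult_def sum_2 p_def r_def t_def sym
        power2_eq_square algebra_simps)
  have pos: "x \<noteq> 0 \<Longrightarrow> x \<bullet> (A *v x) > 0" for x
    using assms by (simp add: euclidean_structure_def)
  have p: "p > 0"
    using pos[of "vector [1, 0]"] form[of "vector [1, 0]"] by (simp add: vec_eq_iff forall_2)
  define \<delta> where "\<delta> = p * t - r\<^sup>2"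
  have "vector [- r, p] \<noteq> (0 :: real^2)" using p by (simp add: vec_eq_iff forall_2)
  then have "p * \<delta> > 0"
    using pos[of "vector [- r, p]"] form[of "vector [- r, p]"]
    by (simp add: \<delta>_def power2_eq_square algebra_simps)
  with p have \<delta>: "\<delta> > 0" by (simp add: zero_less_mult_iff)
  define R :: "real^2^2" where "R = vector [vector [sqrt p, r / sqrt p], vector [0, sqrt (\<delta> / p)]]"
  have "det R = sqrt p * sqrt (\<delta> / p)" by (simp add: R_def det_2)
  then have "invertible R" using p \<delta> by (simp add: invertible_det_nz)
  moreover have "qnorm A x = norm (R *v x)" for x
  proof -
    have "(norm (R *v x))\<^sup>2 = (sqrt p * x$1 + r / sqrt p * x$2)\<^sup>2 + (sqrt (\<delta> / p) * x$2)\<^sup>2"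
      unfolding power2_norm_eq_inner
      by (simp add: R_def inner_vec_def matrix_vector_mult_def sum_2 power2_eq_square)
    also have "\<dots> = p * (x$1)\<^sup>2 + 2 * r * (x$1) * (x$2) + (r\<^sup>2 / p + \<delta> / p) * (x$2)\<^sup>2"
      using p \<delta> by (simp add: power2_sum power_mult_distrib power_divide field_simps)
    also have "\<dots> = x \<bullet> (A *v x)"
      using p unfolding form \<delta>_def by (simp add: field_simps)
    finally show ?thesis
      unfolding qnorm_def by (simp add: real_sqrt_unique)
  qed
  ultimately show ?thesis by (rule that)
qed

lemma image_focal_locus_qnorm:
  fixes R :: "real^2^2"
  assumes "invertible R" and qR: "\<And>x. qnorm A x = norm (R *v x)"
  shows "(*v) R ` {X. qnorm A (X - F1) + qnorm A (X - F2) = a}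
    = {Y. norm (Y - R *v F1) + norm (Y - R *v F2) = a}"
proof -
  have bij: "bij ((*v) R)" using assms(1) invertible_eq_bij by blast
  have "{X. qnorm A (X - F1) + qnorm A (X - F2) = a}
      = {X. norm (R *v X - R *v F1) + norm (R *v X - R *v F2) = a}"
    by (simp add: qR matrix_vector_mult_diff_distrib)
  then show ?thesis
    using bij by (simp add: bij_image_Collect_eq surj_f_inv_f[OF bij_is_surj[OF bij]])
qed

lemma major_axis_length_focal_locus:
  fixes R :: "real^2^2"
  assumes "invertible R" and qR: "\<And>x. qnorm A x = norm (R *v x)"
    and E: "E = {X. qnorm A (X - F1) + qnorm A (X - F2) = a}" and "E \<noteq> {}"
  shows "major_axis_length A E = a"
proof -
  have "major_axis_length A E = (SUP Y\<in>(*v) R ` E. SUP Z\<in>(*v) R ` E. norm (Y - Z))"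
    by (simp add: major_axis_length_def qR matrix_vector_mult_diff_distrib image_image)
  also have "\<dots> = a"
  proof (rule focal_locus_diameter)
    show "(*v) R ` E = {Y. norm (Y - R *v F1) + norm (Y - R *v F2) = a}"
      unfolding E by (rule image_focal_locus_qnorm[OF assms(1) qR])
    show "(*v) R ` E \<noteq> {}" using \<open>E \<noteq> {}\<close> by blast
  qed
  finally show ?thesis .
qed

lemma major_axis_length_mult_focal_chord:
  fixes M A :: "real^2^2"
  assumes M: "invertible M" and E: "E = {c + M *v u | u. norm u = 1}"
    and A: "euclidean_structure A" and foci: "foci A E F1 F2"
    and w1: "norm w1 = 1" and w2: "norm w2 = 1"
    and F1: "F1 \<in> closed_segment (c + M *v w1) (c + M *v w2)"
  shows "major_axis_length A E * (norm (w1 - w2))\<^sup>2 = 4 * qnorm A (M *v w1 - M *v w2)"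
proof -
  obtain R :: "real^2^2" where R: "invertible R" and qR: "\<And>x. qnorm A x = norm (R *v x)"
    using euclidean_structure_factor[OF A] by blast
  obtain a where Ea: "E = {X. qnorm A (X - F1) + qnorm A (X - F2) = a}"
    using foci unfolding foci_def by iprover
  have "c + M *v w1 \<in> E" using w1 unfolding E by blast
  then have major_axis: "major_axis_length A E = a"
    using major_axis_length_focal_locus[OF R qR Ea] by blast
  have "{R *v c + (R ** M) *v u | u. norm u = 1} = (*v) R ` E"
    unfolding E image_Collect[symmetric] image_image
    by (simp add: matrix_vector_right_distrib matrix_vector_mul_assoc)
  also have "\<dots> = {Y. norm (Y - R *v F1) + norm (Y - R *v F2) = a}"
    unfolding Ea by (rule image_focal_locus_qnorm[OF R qR])
  finally interpret focal_ellipsoid "(*v) (R ** M)" "R *v c" "R *v F1" "R *v F2" a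
    using invertible_mult[OF R M]
    by (intro focal_ellipsoid.intro matrix_vector_mul_linear) (auto simp: invertible_eq_bij bij_is_inj)
  have "R *v F1 \<in> closed_segment (R *v (c + M *v w1)) (R *v (c + M *v w2))"
    unfolding closed_segment_linear_image[OF matrix_vector_mul_linear] using F1 by blast
  then have "R *v F1 \<in> closed_segment (R *v c + (R ** M) *v w1) (R *v c + (R ** M) *v w2)"
    by (simp add: matrix_vector_right_distrib matrix_vector_mul_assoc)
  then have "a * (norm (w1 - w2))\<^sup>2 = 4 * norm ((R ** M) *v w1 - (R ** M) *v w2)"
    by (rule focal_chord[OF w1 w2])
  also have "(R ** M) *v w1 - (R ** M) *v w2 = R *v (M *v w1 - M *v w2)"
    by (simp add: matrix_vector_mult_diff_distrib matrix_vector_mul_assoc)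
  finally show ?thesis
    unfolding qR major_axis .
qed

theorem proposition8:
  fixes E :: "(real^2) set" and A B :: "real^2^2" and F1 F2 G1 G2 P Q :: "real^2"
  assumes "is_ellipse E"
    and "euclidean_structure A" and "euclidean_structure B"
    and "foci A E F1 F2" and "foci B E G1 G2"
    and "P \<in> E" and "Q \<in> E" and "P \<noteq> Q"
    and "F1 \<in> closed_segment P Q" and "G1 \<in> closed_segment P Q"
  shows "major_axis_length A E = major_axis_length B E \<longleftrightarrow> qnorm A (P - Q) = qnorm B (P - Q)"
proof -
  obtain M :: "real^2^2" and c where M: "invertible M" and E: "E = {c + M *v u | u. norm u = 1}"
    using assms(1) unfolding is_ellipse_def by iprover
  obtain w1 where w1: "norm w1 = 1" and P: "P = c + M *v w1"
    using assms(6) unfolding E by blast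
  obtain w2 where w2: "norm w2 = 1" and Q: "Q = c + M *v w2"
    using assms(7) unfolding E by blast
  have PQ: "P - Q = M *v w1 - M *v w2" by (simp add: P Q)
  have "major_axis_length A E * (norm (w1 - w2))\<^sup>2 = 4 * qnorm A (P - Q)"
    using major_axis_length_mult_focal_chord[OF M E assms(2,4) w1 w2] assms(9)
    by (simp add: PQ flip: P Q)
  moreover have "major_axis_length B E * (norm (w1 - w2))\<^sup>2 = 4 * qnorm B (P - Q)"
    using major_axis_length_mult_focal_chord[OF M E assms(3,5) w1 w2] assms(10)
    by (simp add: PQ flip: P Q)
  moreover have "w1 \<noteq> w2" using assms(8) by (auto simp: P Q)
  then have "(norm (w1 - w2))\<^sup>2 \<noteq> 0" by simp
  ultimately show ?thesis by (metis mult_cancel_right mult_cancel_left zero_neq_numeral)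
qed

end
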